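(* The Zaremba test is universally detection coherent. That is, let $\mathcal P$ be the set of all pairs $(F_1,F_2)$ of probability distributions on $\mathbb R$, let $\mathcal H_0=\{(F_1,F_2)\in\mathcal P:\mathrm{AUC}(F_1,F_2)=1/2\}$ be the null hypothesis of the test, and let $\mathcal D_0=\{(F_1,F_2)\in\mathcal P:\theta(F_1,F_2)=\theta^*\}$ be its detection-null set, where $\theta=\mathrm{AUC}$ is its detection functional and $\theta^*$ is the constant value of $\theta$ on $\mathcal H_0$. Then $\mathcal S_{\mathcal P}=\mathcal D_0\setminus\mathcal H_0=\emptyset$.
   Context: For independent $X\sim F_1$, $Y\sim F_2$, $\mathrm{AUC}(F_1,F_2)=P(X<Y)+\tfrac12P(X=Y)$. The Zaremba test uses the calibration statistic $\sqrt n(\mathrm{eAUC}-1/2)/\hat\sigma$, calibrated under $\mathrm{AUC}=1/2$. Its detector is $\mathrm{eAUC}=U/(n_1n_2)$, where $U=\sum_{i\le n_1}\sum_{j\le n_2}\mathbf 1(X_i<Y_j)$ (with $\tfrac12\mathbf 1(X_i=Y_j)$ added in case of ties). The detector converges in probability to the detection functional $\theta=\mathrm{AUC}$, and $\theta^*=1/2$. The blind spot is $\mathcal S_{\mathcal P}=\mathcal D_0\setminus\mathcal H_0$. A test is universally detection coherent if $\mathcal S_{\mathcal P}=\emptyset$. *)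

theory Defs
  imports "HOL-Probability.Probability"
begin

definition distribution_pairs :: "(real measure \<times> real measure) set" where
  "distribution_pairs = {(F1, F2). real_distribution F1 \<and> real_distribution F2}"

(* The product measure is the joint law of independent X ~ F1 and Y ~ F2. *)
definition auc :: "real measure \<times> real measure \<Rightarrow> real" where
  "auc = (\<lambda>(F1, F2).
     \<P>(z in F1 \<Otimes>\<^sub>M F2. fst z < snd z) + 1 / 2 * \<P>(z in F1 \<Otimes>\<^sub>M F2. fst z = snd z))"

definition mann_whitney_U :: "nat \<Rightarrow> nat \<Rightarrow> (nat \<Rightarrow> real) \<Rightarrow> (nat \<Rightarrow> real) \<Rightarrow> real" where
  "mann_whitney_U n1 n2 x y =
     (\<Sum>i<n1. \<Sum>j<n2. of_bool (x i < y j) + 1 / 2 * of_bool (x i = y j))"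

definition eAUC :: "nat \<Rightarrow> nat \<Rightarrow> (nat \<Rightarrow> real) \<Rightarrow> (nat \<Rightarrow> real) \<Rightarrow> real" where
  "eAUC n1 n2 x y = mann_whitney_U n1 n2 x y / (real n1 * real n2)"

(* Two independent i.i.d. sequences; samples of sizes n1 and n2 are their initial segments. *)
definition two_sample_space ::
  "real measure \<times> real measure \<Rightarrow> ((nat \<Rightarrow> real) \<times> (nat \<Rightarrow> real)) measure" where
  "two_sample_space = (\<lambda>(F1, F2). (\<Pi>\<^sub>M i\<in>UNIV. F1) \<Otimes>\<^sub>M (\<Pi>\<^sub>M j\<in>UNIV. F2))"

(* The detector T converges in probability to \<theta> for every member of the model P,
   as both sample sizes tend to infinity, with no condition on their ratio. *)
definition is_detection_functional ::
  "(real measure \<times> real measure) set \<Rightarrow>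
   (nat \<Rightarrow> nat \<Rightarrow> (nat \<Rightarrow> real) \<Rightarrow> (nat \<Rightarrow> real) \<Rightarrow> real) \<Rightarrow>
   (real measure \<times> real measure \<Rightarrow> real) \<Rightarrow> bool" where
  "is_detection_functional P T \<theta> \<longleftrightarrow>
     (\<forall>F\<in>P. \<forall>\<epsilon>>0.
        ((\<lambda>(n1, n2). \<P>(\<omega> in two_sample_space F. \<bar>T n1 n2 (fst \<omega>) (snd \<omega>) - \<theta> F\<bar> > \<epsilon>))
           \<longlongrightarrow> 0) (sequentially \<times>\<^sub>F sequentially))"

definition zaremba_null :: "(real measure \<times> real measure) set" where
  "zaremba_null = {F \<in> distribution_pairs. auc F = 1 / 2}"

(* The constant value of \<theta> on a nonempty null H0; unspecified if \<theta> is not constant there. *)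
definition null_value :: "'p set \<Rightarrow> ('p \<Rightarrow> real) \<Rightarrow> real" where
  "null_value H0 \<theta> = (THE c. \<theta> ` H0 = {c})"

definition detection_null :: "'p set \<Rightarrow> 'p set \<Rightarrow> ('p \<Rightarrow> real) \<Rightarrow> 'p set" where
  "detection_null P H0 \<theta> = {F \<in> P. \<theta> F = null_value H0 \<theta>}"

definition blind_spot :: "'p set \<Rightarrow> 'p set \<Rightarrow> ('p \<Rightarrow> real) \<Rightarrow> 'p set" where
  "blind_spot P H0 \<theta> = detection_null P H0 \<theta> - H0"

definition universally_detection_coherent :: "'p set \<Rightarrow> 'p set \<Rightarrow> ('p \<Rightarrow> real) \<Rightarrow> bool" where
  "universally_detection_coherent P H0 \<theta> \<longleftrightarrow> blind_spot P H0 \<theta> = {}"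

end

(* Coherence only needs the null to be nonempty, so that auc takes the single value 1/2 on it.
   The convergence of eAUC is a weak law for a two-sample U-statistic with bounded kernel: in the
   second moment of the centred double sum, the covariance of the (i, j) and (k, l) terms vanishes
   unless i = k or j = l, so the moment is at most n1 n2 (n1 + n2), and Chebyshev's inequality
   bounds the deviation probability by (1/n1 + 1/n2) / epsilon^2. *)
theory Submission
  imports Defs
begin

section \<open>Integrals of coordinate functions over infinite product measures\<close>

lemma (in prob_space) integrable_bounded:
  fixes f :: "'a \<Rightarrow> real"
  assumes "f \<in> borel_measurable M" "\<And>x. \<bar>f x\<bar> \<le> B"
  shows "integrable M f"
  using assms by (intro integrable_const_bound[where B=B]) auto

lemma integral_PiM_coordinate:
  fixes f :: "'a \<Rightarrow> real"
  assumes F: "prob_space F" and [measurable]: "f \<in> borel_measurable F"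
  shows "(\<integral>x. f (x (j :: 'i)) \<partial>(\<Pi>\<^sub>M i\<in>UNIV. F)) = (\<integral>x. f x \<partial>F)"
proof -
  have "(\<integral>x. f x \<partial>F) = (\<integral>x. f x \<partial>distr (\<Pi>\<^sub>M i\<in>(UNIV :: 'i set). F) F (\<lambda>x. x j))"
    using F by (subst distr_PiM_component) auto
  also have "\<dots> = (\<integral>x. f (x j) \<partial>(\<Pi>\<^sub>M i\<in>UNIV. F))"
    by (rule integral_distr) auto
  finally show ?thesis ..
qed

lemma integral_PiM_mult_coordinates:
  fixes a b :: "'a \<Rightarrow> real" and i k :: "'i"
  assumes F: "prob_space F" and ik: "i \<noteq> k"
    and [measurable]: "a \<in> borel_measurable F" "b \<in> borel_measurable F"
    and bounds: "\<And>x. \<bar>a x\<bar> \<le> A" "\<And>x. \<bar>b x\<bar> \<le> B"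
  shows "(\<integral>x. a (x i) * b (x k) \<partial>(\<Pi>\<^sub>M i\<in>UNIV. F)) = (\<integral>x. a x \<partial>F) * (\<integral>x. b x \<partial>F)"
proof -
  let ?M = "\<Pi>\<^sub>M i\<in>(UNIV :: 'i set). F"
  interpret P: prob_space ?M
    using F by (intro prob_space_PiM)
  \<comment> \<open>The product rule for independent variables speaks of one indexed family, so
    \<open>a\<close> and \<open>b\<close> are merged into \<open>Y\<close>; only its values at
    \<open>i\<close> and \<open>k\<close> matter, and \<open>i \<noteq> k\<close> makes the second
    one \<open>b\<close>.\<close>
  define Y where "Y = (\<lambda>j. if j = i then a else b)"
  have [measurable]: "Y j \<in> borel_measurable F" for j
    by (simp add: Y_def)
  have Y_bound: "\<bar>Y j x\<bar> \<le> max A B" for j x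
    using bounds[of x] by (auto simp: Y_def)
  have "distr ?M F (\<lambda>x. x j) = F" for j
    using F distr_PiM_component[of UNIV "\<lambda>_. F" j] by simp
  \<comment> \<open>Independence means that the joint law is the product of the marginals. The joint
    map of all coordinates is the identity and each marginal is \<open>F\<close>, so both sides are
    the product measure itself.\<close>
  then have "P.indep_vars (\<lambda>_. F) (\<lambda>j x. x j) UNIV"
    by (subst P.indep_vars_iff_distr_eq_PiM) (simp_all add: restrict_UNIV distr_id)
  then have "P.indep_vars (\<lambda>_. F) (\<lambda>j x. x j) {i, k}"
    by (rule P.indep_vars_subset) simp
  then have "P.indep_vars (\<lambda>_. borel) (\<lambda>j x. Y j (x j)) {i, k}"
    by (rule P.indep_vars_compose2) measurable
  then have "(\<integral>x. (\<Prod>j\<in>{i, k}. Y j (x j)) \<partial>?M) = (\<Prod>j\<in>{i, k}. \<integral>x. Y j (x j) \<partial>?M)"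
    by (intro P.indep_vars_lebesgue_integral P.integrable_bounded[OF _ Y_bound]) simp_all
  then show ?thesis
    using ik F by (simp add: Y_def integral_PiM_coordinate)
qed

section \<open>Covariances and second moment of the centred double sum\<close>

lemma prob_space_two_sample_space:
  assumes "prob_space F1" "prob_space F2"
  shows "prob_space (two_sample_space (F1, F2))"
  unfolding two_sample_space_def prod.case
  using assms by (intro prob_space_pair prob_space_PiM)

text \<open>With the first sequence fixed, the two factors depend on different coordinates of the
  second one, so the inner integral splits into values of the projection \<open>G\<close>. These sit
  at different coordinates of the first sequence, so the outer integral splits as well, into the
  square of the mean of \<open>g\<close>.\<close>

lemma integral_two_sample_distinct:
  fixes g :: "real \<times> real \<Rightarrow> real"
  assumes F: "prob_space F1" "prob_space F2"
    and [measurable]: "g \<in> borel_measurable (F1 \<Otimes>\<^sub>M F2)"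
    and bound: "\<And>z. \<bar>g z\<bar> \<le> 1"
    and centred: "(\<integral>z. g z \<partial>(F1 \<Otimes>\<^sub>M F2)) = 0"
    and ne: "i \<noteq> k" "j \<noteq> l"
  shows "(\<integral>\<omega>. g (fst \<omega> i, snd \<omega> j) * g (fst \<omega> k, snd \<omega> l) \<partial>two_sample_space (F1, F2)) = 0"
proof -
  let ?M1 = "\<Pi>\<^sub>M i\<in>(UNIV :: nat set). F1" and ?M2 = "\<Pi>\<^sub>M i\<in>(UNIV :: nat set). F2"
  interpret F1: prob_space F1 by fact
  interpret F2: prob_space F2 by fact
  interpret M1: prob_space ?M1 using F by (intro prob_space_PiM)
  interpret M2: prob_space ?M2 using F by (intro prob_space_PiM)
  interpret F: pair_prob_space F1 F2 ..
  interpret M: pair_prob_space ?M1 ?M2 ..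
  define G where "G x = (\<integral>y. g (x, y) \<partial>F2)" for x
  have [measurable]: "G \<in> borel_measurable F1"
    unfolding G_def by measurable
  have g_section[measurable]: "(\<lambda>y. g (x, y)) \<in> borel_measurable F2" if "x \<in> space F1" for x
    using that by measurable
  \<comment> \<open>The bound is wanted for every \<open>x\<close>. Where the section of
    \<open>g\<close> is not integrable, the Bochner integral takes its default value 0, which also
    satisfies it.\<close>
  have G_bound: "\<bar>G x\<bar> \<le> 1" for x
  proof (cases "integrable F2 (\<lambda>y. g (x, y))")
    case True
    then have "\<bar>G x\<bar> \<le> (\<integral>y. \<bar>g (x, y)\<bar> \<partial>F2)"
      unfolding G_def by (intro integral_abs_bound)
    also have "\<dots> \<le> (\<integral>y. 1 \<partial>F2)"
      using True bound by (intro integral_mono) auto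
    finally show ?thesis by (simp add: F2.prob_space)
  qed (simp add: G_def not_integrable_integral_eq)
  have "(\<integral>x. G x \<partial>F1) = (\<integral>z. g z \<partial>(F1 \<Otimes>\<^sub>M F2))"
    unfolding G_def using bound by (intro F.integral_fst' F.integrable_bounded) auto
  then have G_centred: "(\<integral>x. G x \<partial>F1) = 0"
    using centred by simp
  have prod_bound: "\<bar>g z * g w\<bar> \<le> 1" for z w
    using bound[of z] bound[of w] by (simp add: abs_mult mult_le_one)
  have "(\<integral>\<omega>. g (fst \<omega> i, snd \<omega> j) * g (fst \<omega> k, snd \<omega> l) \<partial>(?M1 \<Otimes>\<^sub>M ?M2)) =
        (\<integral>x. \<integral>y. g (x i, y j) * g (x k, y l) \<partial>?M2 \<partial>?M1)"
    by (subst M.integral_fst'[symmetric]) (auto intro!: M.integrable_bounded[OF _ prod_bound])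
  also have "\<dots> = (\<integral>x. G (x i) * G (x k) \<partial>?M1)"
    unfolding G_def using F ne bound
    by (intro Bochner_Integration.integral_cong refl integral_PiM_mult_coordinates g_section)
       (auto simp: space_PiM)
  also have "\<dots> = 0"
    using F ne G_bound G_centred by (subst integral_PiM_mult_coordinates) auto
  finally show ?thesis by (simp add: two_sample_space_def)
qed

lemma two_sample_second_moment:
  fixes g :: "real \<times> real \<Rightarrow> real"
  assumes F: "prob_space F1" "prob_space F2"
    and [measurable]: "g \<in> borel_measurable (F1 \<Otimes>\<^sub>M F2)"
    and bound: "\<And>z. \<bar>g z\<bar> \<le> 1"
    and centred: "(\<integral>z. g z \<partial>(F1 \<Otimes>\<^sub>M F2)) = 0"
  shows "(\<integral>\<omega>. (\<Sum>i<n1. \<Sum>j<n2. g (fst \<omega> i, snd \<omega> j))\<^sup>2 \<partial>two_sample_space (F1, F2))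
           \<le> real n1 * real n2 * (real n1 + real n2)"
proof -
  let ?M = "two_sample_space (F1, F2)" and ?I = "{..<n1} \<times> {..<n2}"
  let ?t = "\<lambda>\<omega> p. g (fst \<omega> (fst p), snd \<omega> (snd p))"
  interpret prob_space ?M
    using F by (rule prob_space_two_sample_space)
  have [measurable]: "(\<lambda>\<omega>. ?t \<omega> p) \<in> borel_measurable ?M" for p :: "nat \<times> nat"
    unfolding two_sample_space_def by simp
  have prod_bound: "\<bar>g z * g w\<bar> \<le> 1" for z w
    using bound[of z] bound[of w] by (simp add: abs_mult mult_le_one)
  have int: "integrable ?M (\<lambda>\<omega>. ?t \<omega> p * ?t \<omega> q)" for p q
    by (rule integrable_bounded[OF _ prod_bound]) measurable
  \<comment> \<open>A product of terms that share an index is at most 1, and the two indicators then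
    add up to 1 or 2. Their sum, unlike the indicator of the disjunction, splits when summed over
    all pairs.\<close>
  have term_bound: "(\<integral>\<omega>. ?t \<omega> p * ?t \<omega> q \<partial>?M) \<le> of_bool (fst p = fst q) + of_bool (snd p = snd q)" for p q
  proof (cases "fst p \<noteq> fst q \<and> snd p \<noteq> snd q")
    case True
    then show ?thesis
      using integral_two_sample_distinct[OF F _ bound centred] by simp
  next
    case False
    have "(\<integral>\<omega>. ?t \<omega> p * ?t \<omega> q \<partial>?M) \<le> (\<integral>\<omega>. 1 \<partial>?M)"
      using prod_bound by (intro integral_mono int) (auto simp: abs_le_iff)
    with False show ?thesis by (auto simp: prob_space)
  qed
  have "(\<integral>\<omega>. (\<Sum>i<n1. \<Sum>j<n2. g (fst \<omega> i, snd \<omega> j))\<^sup>2 \<partial>?M) =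
        (\<integral>\<omega>. (\<Sum>p\<in>?I. \<Sum>q\<in>?I. ?t \<omega> p * ?t \<omega> q) \<partial>?M)"
    by (simp add: sum.cartesian_product power2_eq_square sum_product split_beta)
  also have "\<dots> = (\<Sum>p\<in>?I. \<Sum>q\<in>?I. \<integral>\<omega>. ?t \<omega> p * ?t \<omega> q \<partial>?M)"
    using int by simp
  also have "\<dots> \<le> (\<Sum>p\<in>?I. \<Sum>q\<in>?I. of_bool (fst p = fst q) + of_bool (snd p = snd q))"
    by (intro sum_mono term_bound)
  \<comment> \<open>For fixed \<open>p\<close>, there are \<open>n2\<close> pairs with the same
    first index and \<open>n1\<close> with the same second; \<open>p\<close> itself is counted in
    both groups.\<close>
  also have "\<dots> = (\<Sum>p\<in>?I. real n2 + real n1)"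
  proof (rule sum.cong)
    fix p assume p: "p \<in> ?I"
    have "(\<Sum>q\<in>?I. of_bool (fst p = fst q) + of_bool (snd p = snd q)) =
          (\<Sum>k<n1. \<Sum>l<n2. of_bool (fst p = k) + of_bool (snd p = l) :: real)"
      by (simp add: sum.cartesian_product split_beta)
    also have "\<dots> = real n2 * (\<Sum>k<n1. of_bool (fst p = k)) + real n1 * (\<Sum>l<n2. of_bool (snd p = l))"
      by (simp add: sum.distrib sum_distrib_left)
    also have "\<dots> = real n2 + real n1"
      using p by (auto simp: of_bool_def)
    finally show "(\<Sum>q\<in>?I. of_bool (fst p = fst q) + of_bool (snd p = snd q)) = real n2 + real n1" .
  qed simp
  finally show ?thesis by (simp add: algebra_simps)
qed

section \<open>The AUC kernel: integrand of \<open>auc\<close> and summand of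
  \<open>mann_whitney_U\<close>\<close>

definition auc_kernel :: "real \<times> real \<Rightarrow> real" where
  "auc_kernel = (\<lambda>(x, y). of_bool (x < y) + 1 / 2 * of_bool (x = y))"

lemma auc_kernel_bounds: "0 \<le> auc_kernel z" "auc_kernel z \<le> 1"
  by (auto simp: auc_kernel_def split: prod.split)

lemma auc_kernel_measurable:
  assumes "real_distribution F1" "real_distribution F2"
  shows "auc_kernel \<in> borel_measurable (F1 \<Otimes>\<^sub>M F2)"
proof -
  have "sets (F1 \<Otimes>\<^sub>M F2) = sets (borel \<Otimes>\<^sub>M borel)"
    using assms by (intro sets_pair_measure_cong real_distribution.events_eq_borel)
  moreover have "auc_kernel \<in> borel_measurable (borel \<Otimes>\<^sub>M borel)"
    unfolding auc_kernel_def by measurable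
  ultimately show ?thesis
    using measurable_cong_sets by blast
qed

lemma auc_eq_integral:
  assumes "real_distribution F1" "real_distribution F2"
  shows "auc (F1, F2) = (\<integral>z. auc_kernel z \<partial>(F1 \<Otimes>\<^sub>M F2))"
proof -
  interpret F1: real_distribution F1 by fact
  interpret F2: real_distribution F2 by fact
  interpret F: pair_prob_space F1 F2 ..
  let ?A = "{z \<in> space (F1 \<Otimes>\<^sub>M F2). fst z < snd z}" and ?B = "{z \<in> space (F1 \<Otimes>\<^sub>M F2). fst z = snd z}"
  have [measurable]: "?A \<in> sets (F1 \<Otimes>\<^sub>M F2)" "?B \<in> sets (F1 \<Otimes>\<^sub>M F2)"
    by measurable
  have "(\<integral>z. auc_kernel z \<partial>(F1 \<Otimes>\<^sub>M F2)) =
        (\<integral>z. indicator ?A z + 1 / 2 * indicator ?B z \<partial>(F1 \<Otimes>\<^sub>M F2))"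
    by (intro Bochner_Integration.integral_cong) (auto simp: auc_kernel_def indicator_def)
  also have "\<dots> = auc (F1, F2)"
    by (subst Bochner_Integration.integral_add)
       (auto simp: auc_def Int_absorb2 intro!: F.integrable_bounded[where B=1] split: split_indicator)
  finally show ?thesis ..
qed

text \<open>Moving the constant into each of the \<open>n1 * n2\<close> terms turns the deviation of
  \<open>eAUC\<close> into an average of centred kernel values. Positive sizes let the denominator
  cancel; division by zero would yield 0 on the right.\<close>

lemma eAUC_minus_const:
  assumes "n1 > 0" "n2 > 0"
  shows "eAUC n1 n2 x y - c = (\<Sum>i<n1. \<Sum>j<n2. auc_kernel (x i, y j) - c) / (real n1 * real n2)"
proof -
  have "(\<Sum>i<n1. \<Sum>j<n2. auc_kernel (x i, y j) - c) = mann_whitney_U n1 n2 x y - real n1 * real n2 * c"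
    by (simp only: sum_subtractf mann_whitney_U_def auc_kernel_def prod.case) simp
  then show ?thesis
    using assms by (simp add: eAUC_def diff_divide_distrib)
qed

section \<open>Chebyshev bound and convergence in probability\<close>

lemma eAUC_deviation_bound:
  assumes F: "real_distribution F1" "real_distribution F2" and "\<epsilon> > 0" "n1 > 0" "n2 > 0"
  shows "\<P>(\<omega> in two_sample_space (F1, F2). \<bar>eAUC n1 n2 (fst \<omega>) (snd \<omega>) - auc (F1, F2)\<bar> > \<epsilon>)
           \<le> (1 / real n1 + 1 / real n2) / \<epsilon>\<^sup>2"
proof -
  interpret F1: real_distribution F1 by fact
  interpret F2: real_distribution F2 by fact
  interpret F: pair_prob_space F1 F2 ..
  let ?M = "two_sample_space (F1, F2)" and ?\<theta> = "auc (F1, F2)"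
  interpret M: prob_space ?M
    by (rule prob_space_two_sample_space) unfold_locales
  define g where "g z = auc_kernel z - ?\<theta>" for z
  note [measurable] = auc_kernel_measurable[OF F]
  have int: "integrable (F1 \<Otimes>\<^sub>M F2) auc_kernel"
    using auc_kernel_bounds by (intro F.integrable_bounded[where B=1]) (auto simp: abs_le_iff intro: order_trans[of _ 0])
  \<comment> \<open>The kernel and its mean both lie in [0, 1], so their difference \<open>g\<close>
    is bounded by 1 in absolute value, as the second moment bound demands.\<close>
  have "0 \<le> ?\<theta>" "?\<theta> \<le> 1"
    using auc_kernel_bounds int
    by (auto simp: auc_eq_integral[OF F] intro!: integral_nonneg F.integral_le_const)
  then have bound: "\<bar>g z\<bar> \<le> 1" for z
    using auc_kernel_bounds[of z] by (auto simp: g_def)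
  have centred: "(\<integral>z. g z \<partial>(F1 \<Otimes>\<^sub>M F2)) = 0"
    using int by (simp add: g_def auc_eq_integral[OF F] F.prob_space)
  have [measurable]: "g \<in> borel_measurable (F1 \<Otimes>\<^sub>M F2)"
    unfolding g_def by measurable
  define S where "S \<omega> = (\<Sum>i<n1. \<Sum>j<n2. g (fst \<omega> i, snd \<omega> j))" for \<omega>
  have [measurable]: "S \<in> borel_measurable ?M"
    unfolding S_def two_sample_space_def by simp
  have S_bound: "\<bar>S \<omega>\<bar> \<le> real n1 * real n2" for \<omega>
  proof -
    have "\<bar>S \<omega>\<bar> \<le> (\<Sum>i<n1. \<Sum>j<n2. \<bar>g (fst \<omega> i, snd \<omega> j)\<bar>)"
      unfolding S_def by (intro order_trans[OF sum_abs] sum_mono sum_abs)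
    also have "\<dots> \<le> (\<Sum>i<n1. \<Sum>j<n2. 1)"
      by (intro sum_mono bound)
    finally show ?thesis by simp
  qed
  have "integrable ?M (\<lambda>\<omega>. (S \<omega>)\<^sup>2)"
    using power_mono[OF S_bound, where n=2] by (intro M.integrable_bounded) auto
  moreover have N: "0 < real n1 * real n2 * \<epsilon>"
    using assms by simp
  \<comment> \<open>Chebyshev's inequality for the unnormalised sum: the threshold \<epsilon> is
    scaled by \<open>n1 * n2\<close>. The event here is non-strict and contains the strict deviation
    event of \<open>eAUC\<close>.\<close>
  ultimately have "\<P>(\<omega> in ?M. \<bar>S \<omega>\<bar> \<ge> real n1 * real n2 * \<epsilon>)
      \<le> (\<integral>\<omega>. (S \<omega>)\<^sup>2 \<partial>?M) / (real n1 * real n2 * \<epsilon>)\<^sup>2"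
    by (intro M.second_moment_method) auto
  also have "\<dots> \<le> (real n1 * real n2 * (real n1 + real n2)) / (real n1 * real n2 * \<epsilon>)\<^sup>2"
    unfolding S_def
    by (intro divide_right_mono two_sample_second_moment bound centred) (simp_all, unfold_locales)
  also have "\<dots> = (1 / real n1 + 1 / real n2) / \<epsilon>\<^sup>2"
    using assms by (simp add: field_simps power2_eq_square)
  finally have "\<P>(\<omega> in ?M. \<bar>S \<omega>\<bar> \<ge> real n1 * real n2 * \<epsilon>) \<le> (1 / real n1 + 1 / real n2) / \<epsilon>\<^sup>2" .
  moreover have "\<P>(\<omega> in ?M. \<bar>eAUC n1 n2 (fst \<omega>) (snd \<omega>) - ?\<theta>\<bar> > \<epsilon>)
      \<le> \<P>(\<omega> in ?M. \<bar>S \<omega>\<bar> \<ge> real n1 * real n2 * \<epsilon>)"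
  proof (intro M.finite_measure_mono subsetI)
    fix \<omega>
    assume \<omega>: "\<omega> \<in> {\<omega> \<in> space ?M. \<bar>eAUC n1 n2 (fst \<omega>) (snd \<omega>) - ?\<theta>\<bar> > \<epsilon>}"
    have "eAUC n1 n2 (fst \<omega>) (snd \<omega>) - ?\<theta> = S \<omega> / (real n1 * real n2)"
      unfolding S_def g_def by (rule eAUC_minus_const) fact+
    with \<omega> have "\<epsilon> < \<bar>S \<omega>\<bar> / (real n1 * real n2)"
      by (simp add: abs_mult)
    with \<omega> show "\<omega> \<in> {\<omega> \<in> space ?M. \<bar>S \<omega>\<bar> \<ge> real n1 * real n2 * \<epsilon>}"
      using assms by (simp add: less_divide_eq mult.commute)
  qed measurable
  ultimately show ?thesis by linarith
qed

lemma is_detection_functional_auc: "is_detection_functional distribution_pairs eAUC auc"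
  unfolding is_detection_functional_def
proof (intro ballI allI impI)
  fix F :: "real measure \<times> real measure" and \<epsilon> :: real
  assume "F \<in> distribution_pairs" and \<epsilon>: "\<epsilon> > 0"
  then obtain F1 F2 where F: "F = (F1, F2)" "real_distribution F1" "real_distribution F2"
    by (auto simp: distribution_pairs_def)
  let ?p = "\<lambda>(n1, n2). \<P>(\<omega> in two_sample_space F. \<bar>eAUC n1 n2 (fst \<omega>) (snd \<omega>) - auc F\<bar> > \<epsilon>)"
  let ?b = "\<lambda>n. (1 / real (fst n) + 1 / real (snd n)) / \<epsilon>\<^sup>2"
  \<comment> \<open>Each summand of the bound involves one sample size only, so its limit follows by
    composing with a projection, whatever the ratio of the sizes.\<close>
  have "((\<lambda>n. 1 / real (fst n)) \<longlongrightarrow> 0) (sequentially \<times>\<^sub>F sequentially)"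
    "((\<lambda>n. 1 / real (snd n)) \<longlongrightarrow> 0) (sequentially \<times>\<^sub>F sequentially)"
    using filterlim_compose[OF lim_1_over_n filterlim_fst]
      filterlim_compose[OF lim_1_over_n filterlim_snd] by auto
  then have "(?b \<longlongrightarrow> (0 + 0) / \<epsilon>\<^sup>2) (sequentially \<times>\<^sub>F sequentially)"
    using \<epsilon> by (intro tendsto_intros) auto
  then have b: "(?b \<longlongrightarrow> 0) (sequentially \<times>\<^sub>F sequentially)"
    by simp
  \<comment> \<open>The deviation bound assumes positive sizes, hence the comparison is stated only
    eventually, with positivity as the witness on both factors of the filter.\<close>
  have p_le_b: "eventually (\<lambda>n. ?p n \<le> ?b n) (sequentially \<times>\<^sub>F sequentially)"
    unfolding eventually_prod_filter
    using eAUC_deviation_bound[OF F(2,3) \<epsilon>] eventually_gt_at_top[of "0::nat"]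
    by (intro exI[of _ "\<lambda>n. n > 0"]) (auto simp: F(1))
  show "(?p \<longlongrightarrow> 0) (sequentially \<times>\<^sub>F sequentially)"
    by (rule tendsto_sandwich[OF _ p_le_b tendsto_const b]) (simp add: split_beta)
qed

section \<open>The constant value on the null and coherence\<close>

lemma auc_return_eq: "auc (return borel c, return borel c) = 1 / 2"
proof -
  interpret R: prob_space "return borel c" by (rule prob_space_return) simp
  interpret R: real_distribution "return borel c" by unfold_locales simp
  interpret RR: pair_prob_space "return borel c" "return borel c" ..
  have D: "real_distribution (return borel c)" by unfold_locales
  note [measurable] = auc_kernel_measurable[OF D D]
  have "auc (return borel c, return borel c) =
        (\<integral>x. \<integral>y. auc_kernel (x, y) \<partial>return borel c \<partial>return borel c)"
    unfolding auc_eq_integral[OF D D] using auc_kernel_bounds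
    by (intro RR.integral_fst'[symmetric] RR.integrable_bounded[where B=1])
       (auto simp: abs_le_iff intro: order_trans[of _ 0])
  \<comment> \<open>Two point masses at \<open>c\<close> tie with certainty, so only the tie weight
    1/2 remains.\<close>
  also have "\<dots> = auc_kernel (c, c)"
    by (simp add: integral_return auc_kernel_def)
  finally show ?thesis by (simp add: auc_kernel_def)
qed

text \<open>Membership in the null already fixes the value; the pair of point masses at 0 shows that
  the image is not empty, which is what makes \<open>null_value\<close> well defined.\<close>

lemma auc_image_zaremba_null: "auc ` zaremba_null = {1 / 2}"
proof -
  have "real_distribution (return borel (0::real))"
    by (simp add: real_distribution_def real_distribution_axioms_def prob_space_return)
  then have "(return borel 0, return borel 0) \<in> zaremba_null"
    by (simp add: zaremba_null_def distribution_pairs_def auc_return_eq)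
  then show ?thesis
    by (force simp: zaremba_null_def)
qed

theorem mainTheorem8:
  shows "is_detection_functional distribution_pairs eAUC auc \<and>
         auc ` zaremba_null = {1 / 2} \<and>
         universally_detection_coherent distribution_pairs zaremba_null auc"
proof (intro conjI is_detection_functional_auc auc_image_zaremba_null)
  \<comment> \<open>Once the definite description is evaluated, the detection-null set and the null
    are cut out by the same equation.\<close>
  have "null_value zaremba_null auc = 1 / 2"
    unfolding null_value_def auc_image_zaremba_null by (rule the_equality) auto
  then show "universally_detection_coherent distribution_pairs zaremba_null auc"
    by (auto simp: universally_detection_coherent_def blind_spot_def detection_null_def zaremba_null_def)
qed

end
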